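(* Let $\theta\in(0,1)$, let $X_1,X_2,\ldots$ be i.i.d. random variables uniformly distributed on $[0,1]$, and let $N$ be a random variable independent of $(X_i)_{i\ge1}$ with $\mathbb P(N=n)=\theta(1-\theta)^{n-1}$ for $n=1,2,\ldots$. Let $Y=\max_{1\le i\le N}X_i$ and $Z=\min_{1\le i\le N}X_i$. Then $Y$ has probability density function $$g_Y(y)=\frac{\theta}{[1-(1-\theta)y]^2},\qquad 0\le y\le 1,$$ and $Z$ has probability density function $$g_Z(z)=\frac{\theta}{[\theta+(1-\theta)z]^2},\qquad 0\le z\le 1,$$ both densities being zero outside $[0,1]$.
   Context: Densities are with respect to Lebesgue measure. *)

theory Defs
  imports "HOL-Probability.Probability"
begin

(* The library's indep_var requires both random variables to have values in the same type.
   This is its unfolding (indep_vars_def2) with the two value types allowed to differ. *)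
definition (in prob_space) indep_var_hetero ::
  "'b measure \<Rightarrow> ('a \<Rightarrow> 'b) \<Rightarrow> 'c measure \<Rightarrow> ('a \<Rightarrow> 'c) \<Rightarrow> bool" where
  "indep_var_hetero S A T B \<longleftrightarrow>
    random_variable S A \<and> random_variable T B \<and>
    indep_set {A -` U \<inter> space M | U. U \<in> sets S} {B -` V \<inter> space M | V. V \<in> sets T}"

lemma (in prob_space) indep_var_hetero_iff_indep_var:
  "indep_var_hetero S A T B \<longleftrightarrow> indep_var S A T B"
proof -
  have "(\<lambda>i. {case_bool A B i -` U \<inter> space M | U. U \<in> sets (case_bool S T i)}) =
      case_bool {A -` U \<inter> space M | U. U \<in> sets S} {B -` V \<inter> space M | V. V \<in> sets T}"
    by (rule ext) (simp split: bool.split)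
  then show ?thesis
    unfolding indep_var_hetero_def indep_var_def indep_vars_def2 indep_set_def
    by (auto simp: UNIV_bool)
qed

end

(* Conditioning on N = n, all of X_1, ..., X_N lie in a set E that each X_i hits with probability p
   with probability p^n, so summing the geometric series gives theta p / (1 - (1 - theta) p).
   With E = {..a} this is the distribution function of the maximum, and with E = {a<..} the
   survival function of the minimum; the densities are the derivatives. *)
theory Submission
  imports Defs
begin

text \<open>The fundamental theorem of calculus integrates \<open>f\<close> back to \<open>F\<close>
  on [0,1]. Prescribing the distribution function there suffices: \<open>F 0 = 0\<close> and
  \<open>F 1 = 1\<close> leave no mass outside, by monotonicity. Both extremes are handled by this
  one criterion.\<close>

lemma (in prob_space) distributed_unit_intervalI:
  fixes Y :: "'a \<Rightarrow> real" and f F :: "real \<Rightarrow> real"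
  assumes Y [measurable]: "Y \<in> borel_measurable M" and f [measurable]: "f \<in> borel_measurable borel"
    and cdf: "\<And>a. 0 \<le> a \<Longrightarrow> a \<le> 1 \<Longrightarrow> \<P>(\<omega> in M. Y \<omega> \<le> a) = F a"
    and F01: "F 0 = 0" "F 1 = 1"
    and deriv: "\<And>x. 0 \<le> x \<Longrightarrow> x \<le> 1 \<Longrightarrow> (F has_real_derivative f x) (at x)"
    and nonneg: "\<And>x. 0 \<le> x \<Longrightarrow> x \<le> 1 \<Longrightarrow> 0 \<le> f x"
  shows "distributed M lborel Y (\<lambda>y. ennreal (if 0 \<le> y \<and> y \<le> 1 then f y else 0))"
proof -
  \<comment> \<open>Clamping to [0,1] makes \<open>F (c a)\<close> the distribution function at
    every real \<open>a\<close>.\<close>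
  define c :: "real \<Rightarrow> real" where "c a = max 0 (min 1 a)" for a
  show ?thesis
  proof (rule distributedI_borel_atMost)
    fix a :: real
    have "(\<integral>\<^sup>+ x. ennreal ((if 0 \<le> x \<and> x \<le> 1 then f x else 0) * indicator {..a} x) \<partial>lborel)
        = (\<integral>\<^sup>+ x. ennreal (f x) * indicator {0..c a} x \<partial>lborel)"
    \<comment> \<open>The null point 0 is discarded because for \<open>a < 0\<close> the interval
      \<open>{0..c a}\<close> is \<open>{0}\<close> rather than empty, so the integrands may differ
      there.\<close>
    proof (rule nn_integral_cong_AE, rule AE_mp[OF AE_lborel_singleton[of 0]], rule AE_I2, rule impI)
      fix x :: real assume "x \<noteq> 0"
      then show "ennreal ((if 0 \<le> x \<and> x \<le> 1 then f x else 0) * indicator {..a} x)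
          = ennreal (f x) * indicator {0..c a} x"
        by (cases "x \<le> a"; cases "0 \<le> x"; cases "x \<le> 1") (auto simp: c_def indicator_def)
    qed
    also have "\<dots> = F (c a) - F 0"
    proof (rule nn_integral_FTC_Icc)
      fix x assume "x \<in> {0..c a}"
      then have "0 \<le> x" "x \<le> 1" by (auto simp: c_def)
      then show "(F has_real_derivative f x) (at x)" "0 \<le> f x"
        using deriv nonneg by auto
    qed (simp_all add: c_def)
    finally show "(\<integral>\<^sup>+ x. ennreal ((if 0 \<le> x \<and> x \<le> 1 then f x else 0) * indicator {..a} x) \<partial>lborel)
        = ennreal (F (c a))"
      by (simp add: F01)
    have "prob {\<omega> \<in> space M. Y \<omega> \<le> a} = F (c a)"
    proof -
      \<comment> \<open>Outside [0,1], comparison with the values 0 at 0 and 1 at 1 forces the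
        probability to be 0 or 1.\<close>
      consider "a < 0" | "0 \<le> a" "a \<le> 1" | "1 < a" by linarith
      then show ?thesis
      proof cases
        case 1
        then have "prob {\<omega> \<in> space M. Y \<omega> \<le> a} \<le> prob {\<omega> \<in> space M. Y \<omega> \<le> 0}"
          by (intro finite_measure_mono) auto
        then show ?thesis
          using 1 cdf[of 0] F01 by (simp add: c_def measure_le_0_iff)
      next
        case 2
        then show ?thesis using cdf[of a] by (simp add: c_def)
      next
        case 3
        then have "prob {\<omega> \<in> space M. Y \<omega> \<le> 1} \<le> prob {\<omega> \<in> space M. Y \<omega> \<le> a}"
          by (intro finite_measure_mono) auto
        then show ?thesis
          using 3 cdf[of 1] F01 by (simp add: c_def antisym)
      qed
    qed
    then show "emeasure M {\<omega> \<in> space M. Y \<omega> \<le> a} = ennreal (F (c a))"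
      by (simp add: emeasure_eq_measure)
  qed (auto simp: nonneg)
qed

text \<open>Keeping \<open>E\<close> general lets one series serve three times: for the maximum, for
  the minimum and, with \<open>E = UNIV\<close>, for the almost sure positivity of \<open>N\<close>.
  The conjunct \<open>1 \<le> N \<omega>\<close> excludes \<open>N \<omega> = 0\<close>, where the
  condition on the \<open>X i\<close> would be vacuous.\<close>

lemma (in prob_space) prob_ball_geometric_index:
  fixes X :: "nat \<Rightarrow> 'a \<Rightarrow> 'b" and N :: "'a \<Rightarrow> nat"
  assumes \<theta>: "0 < \<theta>" "\<theta> < 1"
    and X: "indep_vars (\<lambda>_. S) X {1..}"
    and XN: "indep_var_hetero (\<Pi>\<^sub>M i\<in>{1..}. S) (\<lambda>\<omega>. \<lambda>i\<in>{1..}. X i \<omega>) (count_space UNIV) N"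
    and N: "\<And>n. n \<ge> 1 \<Longrightarrow> prob {\<omega> \<in> space M. N \<omega> = n} = \<theta> * (1 - \<theta>) ^ (n - 1)"
    and E [measurable]: "E \<in> sets S"
    and p: "\<And>i. i \<ge> 1 \<Longrightarrow> prob {\<omega> \<in> space M. X i \<omega> \<in> E} = p"
  shows "\<P>(\<omega> in M. 1 \<le> N \<omega> \<and> (\<forall>i\<in>{1..N \<omega>}. X i \<omega> \<in> E)) = \<theta> * p / (1 - (1 - \<theta>) * p)"
proof -
  have X_meas: "random_variable S (X i)" if "i \<ge> 1" for i
    using X that unfolding indep_vars_def by auto
  have [measurable]: "random_variable (count_space UNIV) N"
    using XN unfolding indep_var_hetero_def by simp
  \<comment> \<open>The shift by one starts the series at exponent 0, with first term
    \<open>\<theta> * p\<close> and ratio \<open>(1 - \<theta>) * p\<close>.\<close>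
  define A where "A n = {\<omega> \<in> space M. N \<omega> = Suc n \<and> (\<forall>i\<in>{1..Suc n}. X i \<omega> \<in> E)}" for n
  have prob_A: "prob (A n) = (\<theta> * p) * ((1 - \<theta>) * p) ^ n" for n
  proof -
    let ?B = "{\<omega> \<in> space M. \<forall>i\<in>{1..Suc n}. X i \<omega> \<in> E}"
    \<comment> \<open>\<open>N\<close> is independent of the sequence as a whole, so
      \<open>?B\<close> has to be exhibited as the preimage of a measurable cylinder in the product
      space.\<close>
    let ?U = "{x \<in> space (\<Pi>\<^sub>M i\<in>{1..}. S). \<forall>i\<in>{1..Suc n}. x i \<in> E}"
    let ?Y = "\<lambda>\<omega>. \<lambda>i\<in>{1..}. X i \<omega>"
    have U: "?U \<in> sets (\<Pi>\<^sub>M i\<in>{1..}. S)"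
    proof -
      have "{x \<in> space (\<Pi>\<^sub>M i\<in>{1..}. S). x i \<in> E} \<in> sets (\<Pi>\<^sub>M i\<in>{1..}. S)"
        if "i \<in> {1..Suc n}" for i
        using that by (intro predE pred_sets2[OF E] measurable_component_singleton) auto
      then show ?thesis
        by (intro sets.sets_Collect_finite_All) auto
    qed
    have "?Y \<in> M \<rightarrow>\<^sub>M (\<Pi>\<^sub>M i\<in>{1..}. S)"
      using XN unfolding indep_var_hetero_def by simp
    from measurable_space[OF this] have "?Y -` ?U \<inter> space M = ?B"
      by auto
    then have "?B \<in> {?Y -` U \<inter> space M |U. U \<in> sets (\<Pi>\<^sub>M i\<in>{1..}. S)}"
      using U by blast
    moreover have "{\<omega> \<in> space M. N \<omega> = Suc n} \<in> {N -` V \<inter> space M |V. V \<in> sets (count_space UNIV)}"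
      by (auto intro!: exI[of _ "{Suc n}"])
    ultimately have "prob (?B \<inter> {\<omega> \<in> space M. N \<omega> = Suc n})
        = prob ?B * prob {\<omega> \<in> space M. N \<omega> = Suc n}"
      using XN unfolding indep_var_hetero_def by (blast intro: indep_setD)
    \<comment> \<open>Here the mutual independence of the \<open>X i\<close> enters, as opposed to
      their independence from \<open>N\<close>.\<close>
    moreover have "prob ?B = p ^ Suc n"
    proof -
      have "?B = (\<Inter>i\<in>{1..Suc n}. X i -` E \<inter> space M)"
        by auto
      also have "prob \<dots> = (\<Prod>i\<in>{1..Suc n}. prob (X i -` E \<inter> space M))"
        by (rule indep_varsD[OF X]) auto
      also have "\<dots> = (\<Prod>i\<in>{1..Suc n}. p)"
      proof (rule prod.cong)
        fix i assume "i \<in> {1..Suc n}"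
        moreover have "X i -` E \<inter> space M = {\<omega> \<in> space M. X i \<omega> \<in> E}" by auto
        ultimately show "prob (X i -` E \<inter> space M) = p" using p[of i] by simp
      qed simp
      finally show ?thesis by simp
    qed
    moreover have "A n = ?B \<inter> {\<omega> \<in> space M. N \<omega> = Suc n}"
      by (auto simp: A_def)
    ultimately show ?thesis
      using N[of "Suc n"] by (simp add: power_mult_distrib)
  qed
  have "range A \<subseteq> events"
  proof safe
    fix n
    have "{\<omega> \<in> space M. X i \<omega> \<in> E} \<in> events" if "i \<in> {1..Suc n}" for i
      using that by (intro predE pred_sets2[OF E] X_meas) auto
    then have "{\<omega> \<in> space M. \<forall>i\<in>{1..Suc n}. X i \<omega> \<in> E} \<in> events"
      by (intro sets.sets_Collect_finite_All) auto
    moreover have "{\<omega> \<in> space M. N \<omega> = Suc n} \<in> events"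
      by measurable
    ultimately show "A n \<in> events"
      unfolding A_def by (intro sets.sets_Collect_conj)
  qed
  moreover have "disjoint_family A"
    by (auto simp: disjoint_family_on_def A_def)
  ultimately have "(\<lambda>n. prob (A n)) sums prob (\<Union>n. A n)"
    by (rule finite_measure_UNION)
  moreover have "(\<lambda>n. prob (A n)) sums (\<theta> * p * (1 / (1 - (1 - \<theta>) * p)))"
  proof -
    \<comment> \<open>As a probability, \<open>p\<close> keeps the ratio at most
      \<open>1 - \<theta> < 1\<close>, so the series converges even for
      \<open>p = 1\<close>.\<close>
    have "0 \<le> p" "p \<le> 1"
      using p[of 1] measure_nonneg[of M] prob_le_1 by force+
    then have "0 \<le> (1 - \<theta>) * p" "(1 - \<theta>) * p \<le> 1 - \<theta>"
      using \<theta> by (auto simp: mult_left_le)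
    then have "norm ((1 - \<theta>) * p) < 1"
      using \<theta> by (simp only: real_norm_def abs_of_nonneg)
    then show ?thesis
      unfolding prob_A by (intro sums_mult geometric_sums)
  qed
  moreover have "(\<Union>n. A n) = {\<omega> \<in> space M. 1 \<le> N \<omega> \<and> (\<forall>i\<in>{1..N \<omega>}. X i \<omega> \<in> E)}"
  proof (intro set_eqI iffI)
    fix \<omega> assume "\<omega> \<in> {\<omega> \<in> space M. 1 \<le> N \<omega> \<and> (\<forall>i\<in>{1..N \<omega>}. X i \<omega> \<in> E)}"
    then have "\<omega> \<in> A (N \<omega> - 1)" by (auto simp: A_def)
    then show "\<omega> \<in> (\<Union>n. A n)" by blast
  qed (auto simp: A_def)
  ultimately show ?thesis
    using sums_unique2 by fastforce
qed

theorem mainTheorem2: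
  fixes M :: "'a measure" and \<theta> :: real
    and X :: "nat \<Rightarrow> 'a \<Rightarrow> real" and N :: "'a \<Rightarrow> nat"
  assumes "prob_space M"
    and "0 < \<theta>" and "\<theta> < 1"
    and "prob_space.indep_vars M (\<lambda>_. borel) X {1..}"
    and "\<And>i. i \<ge> 1 \<Longrightarrow>
      distributed M lborel (X i) (\<lambda>x. indicator {0..1} x / measure lborel {0..1::real})"
    and "prob_space.indep_var_hetero M
      (\<Pi>\<^sub>M i\<in>{1..}. borel) (\<lambda>\<omega>. \<lambda>i\<in>{1..}. X i \<omega>) (count_space UNIV) N"
    and "\<And>n. n \<ge> 1 \<Longrightarrow>
      measure M {\<omega> \<in> space M. N \<omega> = n} = \<theta> * (1 - \<theta>) ^ (n - 1)"
  shows "distributed M lborel (\<lambda>\<omega>. Max ((\<lambda>i. X i \<omega>) ` {1..N \<omega>}))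
        (\<lambda>y. ennreal (if 0 \<le> y \<and> y \<le> 1 then \<theta> / (1 - (1 - \<theta>) * y)\<^sup>2 else 0))
    \<and> distributed M lborel (\<lambda>\<omega>. Min ((\<lambda>i. X i \<omega>) ` {1..N \<omega>}))
        (\<lambda>z. ennreal (if 0 \<le> z \<and> z \<le> 1 then \<theta> / (\<theta> + (1 - \<theta>) * z)\<^sup>2 else 0))"
proof -
  interpret prob_space M by fact
  note \<theta> = assms(2,3)
  note geometric = prob_ball_geometric_index[OF assms(2,3,4,6,7)]
  have X_meas: "random_variable borel (X i)" if "i \<ge> 1" for i
    using assms(4) that unfolding indep_vars_def by auto
  have N_meas [measurable]: "random_variable (count_space UNIV) N"
    using assms(6) unfolding indep_var_hetero_def by simp
  let ?Max = "\<lambda>\<omega>. Max ((\<lambda>i. X i \<omega>) ` {1..N \<omega>})"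
  let ?Min = "\<lambda>\<omega>. Min ((\<lambda>i. X i \<omega>) ` {1..N \<omega>})"
  \<comment> \<open>The index set is random, but \<open>N\<close> has countably many values and each
    of them fixes a finite index set.\<close>
  have Max_meas [measurable]: "?Max \<in> borel_measurable M"
    by (rule measurable_compose_countable[OF _ N_meas]) (auto intro!: borel_measurable_Max X_meas)
  have Min_meas [measurable]: "?Min \<in> borel_measurable M"
    by (rule measurable_compose_countable[OF _ N_meas]) (auto intro!: borel_measurable_Min X_meas)
  \<comment> \<open>With \<open>E = UNIV\<close> and \<open>p = 1\<close> the formula gives
    \<open>\<theta> / (1 - (1 - \<theta>)) = 1\<close>.\<close>
  have "\<P>(\<omega> in M. 1 \<le> N \<omega>) = 1"
    using geometric[of UNIV 1] \<theta> by (simp add: prob_space)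
  then have N_pos: "AE \<omega> in M. 1 \<le> N \<omega>"
    by (subst prob_Collect_eq_1[symmetric]) auto
  have X_le: "prob {\<omega> \<in> space M. X i \<omega> \<le> a} = a" if "i \<ge> 1" "0 \<le> a" "a \<le> 1" for i a
    using uniform_distributed_measure[OF assms(5)[OF that(1)] that(2,3)] by simp
  have X_gt: "prob {\<omega> \<in> space M. a < X i \<omega>} = 1 - a" if "i \<ge> 1" "0 \<le> a" "a \<le> 1" for i a
  proof -
    note [measurable] = X_meas[OF that(1)]
    show ?thesis
      using prob_neg[of "\<lambda>\<omega>. X i \<omega> \<le> a"] X_le[OF that] by (simp add: not_le)
  qed
  have pos_max: "0 < 1 - (1 - \<theta>) * a" if "0 \<le> a" "a \<le> 1" for a
    using mult_left_le[of a "1 - \<theta>"] that \<theta> by linarith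
  have pos_min: "0 < \<theta> + (1 - \<theta>) * a" if "0 \<le> a" for a
    using that \<theta> by (simp add: add_pos_nonneg)
  have cdf_Max: "\<P>(\<omega> in M. ?Max \<omega> \<le> a) = \<theta> * a / (1 - (1 - \<theta>) * a)" if a: "0 \<le> a" "a \<le> 1" for a
  proof -
    have "\<P>(\<omega> in M. ?Max \<omega> \<le> a) = \<P>(\<omega> in M. 1 \<le> N \<omega> \<and> ?Max \<omega> \<le> a)"
    \<comment> \<open>On the null event \<open>N \<omega> = 0\<close> the maximum is taken over the
      empty set and says nothing about the \<open>X i\<close>; restricting to
      \<open>1 \<le> N \<omega>\<close> makes the set nonempty, so that \<open>Max\<close> is at
      most \<open>a\<close> exactly when all entries are.\<close>
    proof (rule finite_measure_eq_AE)
      show "AE \<omega> in M. \<omega> \<in> {\<omega> \<in> space M. ?Max \<omega> \<le> a}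
          \<longleftrightarrow> \<omega> \<in> {\<omega> \<in> space M. 1 \<le> N \<omega> \<and> ?Max \<omega> \<le> a}"
        using N_pos by eventually_elim simp
    qed measurable
    also have "\<dots> = \<P>(\<omega> in M. 1 \<le> N \<omega> \<and> (\<forall>i\<in>{1..N \<omega>}. X i \<omega> \<in> {..a}))"
      by (intro arg_cong[of _ _ prob] Collect_cong conj_cong refl) auto
    also have "\<dots> = \<theta> * a / (1 - (1 - \<theta>) * a)"
      using X_le[OF _ a] by (intro geometric) auto
    finally show ?thesis .
  qed
  have cdf_Min: "\<P>(\<omega> in M. ?Min \<omega> \<le> a) = a / (\<theta> + (1 - \<theta>) * a)" if a: "0 \<le> a" "a \<le> 1" for a
  proof -
    \<comment> \<open>Passing to the complement turns an existential condition on the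
      \<open>X i\<close> into a universal one: the minimum exceeds \<open>a\<close> exactly when
      every entry does.\<close>
    have "1 - \<P>(\<omega> in M. ?Min \<omega> \<le> a) = \<P>(\<omega> in M. \<not> ?Min \<omega> \<le> a)"
      by (rule prob_neg[symmetric]) measurable
    also have "\<dots> = \<P>(\<omega> in M. 1 \<le> N \<omega> \<and> a < ?Min \<omega>)"
    proof (rule finite_measure_eq_AE)
      show "AE \<omega> in M. \<omega> \<in> {\<omega> \<in> space M. \<not> ?Min \<omega> \<le> a}
          \<longleftrightarrow> \<omega> \<in> {\<omega> \<in> space M. 1 \<le> N \<omega> \<and> a < ?Min \<omega>}"
        using N_pos by eventually_elim (simp add: not_le)
    qed measurable
    also have "\<dots> = \<P>(\<omega> in M. 1 \<le> N \<omega> \<and> (\<forall>i\<in>{1..N \<omega>}. X i \<omega> \<in> {a<..}))"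
      by (intro arg_cong[of _ _ prob] Collect_cong conj_cong refl) auto
    also have "\<dots> = \<theta> * (1 - a) / (1 - (1 - \<theta>) * (1 - a))"
      using X_gt[OF _ a] by (intro geometric) auto
    also have "1 - (1 - \<theta>) * (1 - a) = \<theta> + (1 - \<theta>) * a"
      by (simp add: algebra_simps)
    finally have "\<P>(\<omega> in M. ?Min \<omega> \<le> a) = 1 - \<theta> * (1 - a) / (\<theta> + (1 - \<theta>) * a)"
      by linarith
    also have "\<dots> = a / (\<theta> + (1 - \<theta>) * a)"
      using pos_min[OF a(1)] by (simp add: field_simps)
    finally show ?thesis .
  qed
  show ?thesis
  proof
    show "distributed M lborel ?Max
        (\<lambda>y. ennreal (if 0 \<le> y \<and> y \<le> 1 then \<theta> / (1 - (1 - \<theta>) * y)\<^sup>2 else 0))"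
    proof (rule distributed_unit_intervalI[OF Max_meas _ cdf_Max])
      fix x :: real assume x: "0 \<le> x" "x \<le> 1"
      \<comment> \<open>In the quotient rule the terms in \<open>x\<close> cancel, leaving the
        numerator \<open>\<theta>\<close>. The denominator is positive also at the endpoints, so the
        derivative there is two-sided.\<close>
      show "((\<lambda>a. \<theta> * a / (1 - (1 - \<theta>) * a)) has_real_derivative \<theta> / (1 - (1 - \<theta>) * x)\<^sup>2) (at x)"
        using pos_max[OF x]
        by (auto intro!: derivative_eq_intros simp: power2_eq_square) (simp add: field_simps)
    qed (use \<theta> in auto)
    show "distributed M lborel ?Min
        (\<lambda>z. ennreal (if 0 \<le> z \<and> z \<le> 1 then \<theta> / (\<theta> + (1 - \<theta>) * z)\<^sup>2 else 0))"
    proof (rule distributed_unit_intervalI[OF Min_meas _ cdf_Min])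
      fix x :: real assume x: "0 \<le> x" "x \<le> 1"
      \<comment> \<open>The same cancellation:
        \<open>\<theta> + (1 - \<theta>) * x - x * (1 - \<theta>)\<close> is
        \<open>\<theta>\<close>.\<close>
      show "((\<lambda>a. a / (\<theta> + (1 - \<theta>) * a)) has_real_derivative \<theta> / (\<theta> + (1 - \<theta>) * x)\<^sup>2) (at x)"
        using pos_min[OF x(1)]
        by (auto intro!: derivative_eq_intros simp: power2_eq_square)
    qed (use \<theta> in auto)
  qed
qed

end
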